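(* Assume that the perceived waiting/idle time functions of travelers/TSPs are linear, i.e. $\Psi_i=\Psi_i^l$ for all $i\in\mathcal I$ and $\Phi_{mn}=\Phi_{mn}^l$ for all $(m,n)\in\mathcal{MN}$. Let SLMFG-L be the bilevel problem and MPEC-L its KKT-based single-level reformulation, both defined in the context. a) If $(p,q,l,u,w,\Delta,x,y)$ is a global solution of SLMFG-L, then for every $(\lambda,\mu)\in\Lambda(p,q,l,u,w,\Delta,x,y)$, the point $(p,q,l,u,w,\Delta,x,y,\lambda,\mu)$ is a global solution of MPEC-L. b) Assume additionally that (i) $b_i\ge p_{\min}$ for every traveler $i\in\mathcal I$, and (ii) $\beta_{mn}\le q_{\max}$ for every $m\in\mathcal M$, $n\in\mathcal N_m$. If $(p,q,l,u,w,\Delta,x,y,\lambda,\mu)$ is a global solution of MPEC-L, then $(p,q,l,u,w,\Delta,x,y)$ is a global solution of SLMFG-L.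
   Context: Data. $\mathcal I$ is a finite set of travelers, $\mathcal M$ a finite set of travel modes, $\mathcal N_m$ a finite set of transportation service providers (TSPs) of mode $m$, $\mathcal{MN}=\{(m,n): m\in\mathcal M, n\in\mathcal N_m\}$. Real parameters: for $i\in\mathcal I$: $D_i,T_i,\alpha_i>0$, $Q_i=D_i^2/T_i$, and $b_i,r_i,B_i,R_i,\Gamma_i\ge 0$; for $(m,n)\in\mathcal{MN}$: $C_{mn},\eta_{mn}>0$ and $\beta_{mn},\gamma_{mn},\rho_{mn},\bar B_{mn}\ge 0$; for $m\in\mathcal M$: $v_m>0$, $\sigma_m\ge0$; bounds $p_{\min}\le p_{\max}$, $q_{\min}\le q_{\max}$ (nonnegative), $\overline C=\sum_{m\in\mathcal M}\sum_{n\in\mathcal N_m}C_{mn}$ and $0\le\underline C\le\overline C$; and $\zeta,\kappa,\vartheta,\xi>0$. Linear perceived time functions: $\Psi_i^l(x_i,\Delta)=-\frac{\zeta}{\overline C}(\Delta+Q_ix_i)+\vartheta$, $\Phi_{mn}^l(y_{mn},\Delta)=\frac{\kappa}{\overline C}(\Delta-C_{mn}y_{mn})+\xi$. Leader variables: $p,q,\Delta\in\mathbb R$, $l=(l_i^m)_{i\in\mathcal I,m\in\mathcal M}$, $u=(u_i)_{i\in\mathcal I}$, $w=(w_{mn})_{(m,n)\in\mathcal{MN}}$. Follower variables: $x=(x_i)_{i\in\mathcal I}$, $y=(y_{mn})_{(m,n)\in\mathcal{MN}}$. Leader objective (to be maximized): $F=\sum_{i\in\mathcal I}b_iQ_ix_i-\sum_{(m,n)\in\mathcal{MN}}\beta_{mn}C_{mn}y_{mn}$.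 Leader constraints: for all $i\in\mathcal I$: $\sum_m v_ml_i^m=D_ix_i$; $0\le\sum_m l_i^m-T_ix_i\le R_i$; $\sum_m\sigma_ml_i^m\le\Gamma_i$; $b_i-p\ge(1-u_i)(b_i-p_{\max})$; $b_i-p\le u_i(b_i-p_{\min})$; $u_i\in\{0,1\}$; $l_i^m\ge0$ for all $m$. For all $m\in\mathcal M$: $\sum_i v_m^2l_i^m\le\sum_{n\in\mathcal N_m}C_{mn}y_{mn}$. For all $(m,n)\in\mathcal{MN}$: $q-\beta_{mn}\ge(1-w_{mn})(q_{\min}-\beta_{mn})$; $q-\beta_{mn}\le w_{mn}(q_{\max}-\beta_{mn})$; $w_{mn}\in\{0,1\}$. Also $\Delta=\sum_{(m,n)}C_{mn}y_{mn}-\sum_iQ_ix_i$; $p_{\min}\le p\le p_{\max}$; $q_{\min}\le q\le q_{\max}$; $\underline C\le\Delta\le\overline C$. Follower problems (the leader variables $u_i,w_{mn},\Delta$ are treated as fixed parameters). Traveler $i$: minimize over $\hat x_i\in\mathcal S_i(u_i)=\{\hat x_i\in\mathbb R: b_iQ_i\hat x_i\le B_i,\ \hat x_i\le u_i,\ \hat x_i\ge0\}$ the function $G_i(\hat x_i,\Delta)=b_iQ_i\hat x_i+r_iQ_i(1-\hat x_i)+\alpha_i\Psi_i(\hat x_i,\Delta)$. TSP $mn$: maximize over $\hat y_{mn}\in\mathcal S_{mn}(w_{mn})=\{\hat y_{mn}\in\mathbb R: C_{mn}\gamma_{mn}\hat y_{mn}\le\bar B_{mn},\ \hat y_{mn}\le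 w_{mn},\ \hat y_{mn}\ge0\}$ the function $H_{mn}(\hat y_{mn},\Delta)=(\beta_{mn}-\gamma_{mn})C_{mn}\hat y_{mn}+(\rho_{mn}-\gamma_{mn})C_{mn}(1-\hat y_{mn})-\eta_{mn}\Phi_{mn}(\hat y_{mn},\Delta)$. SLMFG-L (optimistic form): maximize $F$ over all $(p,q,l,u,w,\Delta,x,y)$ satisfying the leader constraints and such that, with $\Psi_i=\Psi_i^l$, $\Phi_{mn}=\Phi_{mn}^l$, $x_i$ is an optimal solution of traveler $i$'s problem for each $i$ and $y_{mn}$ is an optimal solution of TSP $mn$'s problem for each $(m,n)$. KKT conditions. Multipliers $\lambda=(\lambda_1^i,\lambda_2^i,\lambda_3^i)_{i\in\mathcal I}$, $\mu=(\mu_1^{mn},\mu_2^{mn},\mu_3^{mn})_{(m,n)\in\mathcal{MN}}$; $0\le a\perp b\ge0$ means $a,b\ge0$ and $ab=0$. Traveler $i$: $0\le B_i-b_iQ_ix_i\perp\lambda_1^i\ge0$, $0\le u_i-x_i\perp\lambda_2^i\ge0$, $0\le x_i\perp\lambda_3^i\ge0$, and $(b_i-r_i)Q_i-\alpha_i\frac{\zeta}{\overline C}Q_i+\lambda_1^ib_iQ_i+\lambda_2^i-\lambda_3^i=0$. TSP $mn$: $0\le\bar B_{mn}-C_{mn}\gamma_{mn}y_{mn}\perp\mu_1^{mn}\ge0$, $0\le w_{mn}-y_{mn}\perp\mu_2^{mn}\ge0$, $0\le y_{mn}\perp\mu_3^{mn}\ge0$, and $(\rho_{mn}-\beta_{mn})C_{mn}-\eta_{mn}\frac{\kappa}{\overline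 C}C_{mn}+\mu_1^{mn}C_{mn}\gamma_{mn}+\mu_2^{mn}-\mu_3^{mn}=0$. $\Lambda(p,q,l,u,w,\Delta,x,y)$ is the set of all $(\lambda,\mu)$ for which the KKT conditions of all travelers and all TSPs hold at that point. MPEC-L: maximize $F$ over all $(p,q,l,u,w,\Delta,x,y,\lambda,\mu)$ satisfying the leader constraints and the KKT conditions of all travelers and TSPs. A global solution of a maximization problem is a feasible point whose objective value is at least that of every feasible point. *)

theory Defs
  imports Complex_Main
begin

text \<open>
  Vectors indexed by a finite set are total functions; every notion below depends only on
  their values on the travelers, the modes and the pairs in \<open>MN\<close>.
\<close>

record ('i, 'm, 'n) slmfg_data =
  travelers :: "'i set"
  modes :: "'m set"
  tsps :: "'m \<Rightarrow> 'n set"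
  D_par :: "'i \<Rightarrow> real"
  T_par :: "'i \<Rightarrow> real"
  alpha_par :: "'i \<Rightarrow> real"
  b_par :: "'i \<Rightarrow> real"
  r_par :: "'i \<Rightarrow> real"
  B_par :: "'i \<Rightarrow> real"
  R_par :: "'i \<Rightarrow> real"
  Gamma_par :: "'i \<Rightarrow> real"
  C_par :: "'m \<times> 'n \<Rightarrow> real"
  eta_par :: "'m \<times> 'n \<Rightarrow> real"
  beta_par :: "'m \<times> 'n \<Rightarrow> real"
  gamma_par :: "'m \<times> 'n \<Rightarrow> real"
  rho_par :: "'m \<times> 'n \<Rightarrow> real"
  Bbar_par :: "'m \<times> 'n \<Rightarrow> real"
  v_par :: "'m \<Rightarrow> real"
  sigma_par :: "'m \<Rightarrow> real"
  p_min :: real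
  p_max :: real
  q_min :: real
  q_max :: real
  C_low :: real
  zeta_par :: real
  kappa_par :: real
  theta_par :: real
  xi_par :: real

definition MN :: "('i, 'm, 'n) slmfg_data \<Rightarrow> ('m \<times> 'n) set" where
  "MN P = Sigma (modes P) (tsps P)"

definition Q_par :: "('i, 'm, 'n) slmfg_data \<Rightarrow> 'i \<Rightarrow> real" where
  "Q_par P i = (D_par P i)\<^sup>2 / T_par P i"

definition C_up :: "('i, 'm, 'n) slmfg_data \<Rightarrow> real" where
  "C_up P = (\<Sum>m\<in>modes P. \<Sum>n\<in>tsps P m. C_par P (m, n))"

definition valid_data :: "('i, 'm, 'n) slmfg_data \<Rightarrow> bool" where
  "valid_data P \<longleftrightarrow>
     finite (travelers P) \<and> finite (modes P) \<and> (\<forall>m\<in>modes P. finite (tsps P m)) \<and>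
     (\<forall>i\<in>travelers P.
        D_par P i > 0 \<and> T_par P i > 0 \<and> alpha_par P i > 0 \<and>
        b_par P i \<ge> 0 \<and> r_par P i \<ge> 0 \<and> B_par P i \<ge> 0 \<and> R_par P i \<ge> 0 \<and> Gamma_par P i \<ge> 0) \<and>
     (\<forall>k\<in>MN P.
        C_par P k > 0 \<and> eta_par P k > 0 \<and>
        beta_par P k \<ge> 0 \<and> gamma_par P k \<ge> 0 \<and> rho_par P k \<ge> 0 \<and> Bbar_par P k \<ge> 0) \<and>
     (\<forall>m\<in>modes P. v_par P m > 0 \<and> sigma_par P m \<ge> 0) \<and>
     0 \<le> p_min P \<and> p_min P \<le> p_max P \<and>
     0 \<le> q_min P \<and> q_min P \<le> q_max P \<and>
     0 \<le> C_low P \<and> C_low P \<le> C_up P \<and>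
     zeta_par P > 0 \<and> kappa_par P > 0 \<and> theta_par P > 0 \<and> xi_par P > 0"

text \<open>
  The linear perceived time functions.  If there is no TSP at all then \<open>C_up P = 0\<close>, and the
  quotients by \<open>C_up P\<close> here and in the KKT conditions are \<open>0\<close>.
\<close>

definition Psi_lin :: "('i, 'm, 'n) slmfg_data \<Rightarrow> 'i \<Rightarrow> real \<Rightarrow> real \<Rightarrow> real" where
  "Psi_lin P i xi \<Delta> = - (zeta_par P / C_up P) * (\<Delta> + Q_par P i * xi) + theta_par P"

definition Phi_lin :: "('i, 'm, 'n) slmfg_data \<Rightarrow> 'm \<times> 'n \<Rightarrow> real \<Rightarrow> real \<Rightarrow> real" where
  "Phi_lin P k yk \<Delta> = kappa_par P / C_up P * (\<Delta> - C_par P k * yk) + xi_par P"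

definition leader_objective ::
  "('i, 'm, 'n) slmfg_data \<Rightarrow> ('i \<Rightarrow> real) \<Rightarrow> ('m \<times> 'n \<Rightarrow> real) \<Rightarrow> real" where
  "leader_objective P x y =
     (\<Sum>i\<in>travelers P. b_par P i * Q_par P i * x i) -
     (\<Sum>k\<in>MN P. beta_par P k * C_par P k * y k)"

definition leader_constraints ::
  "('i, 'm, 'n) slmfg_data \<Rightarrow> real \<Rightarrow> real \<Rightarrow> ('i \<Rightarrow> 'm \<Rightarrow> real) \<Rightarrow> ('i \<Rightarrow> real) \<Rightarrow>
   ('m \<times> 'n \<Rightarrow> real) \<Rightarrow> real \<Rightarrow> ('i \<Rightarrow> real) \<Rightarrow> ('m \<times> 'n \<Rightarrow> real) \<Rightarrow> bool" where
  "leader_constraints P p q l u w \<Delta> x y \<longleftrightarrow>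
     (\<forall>i\<in>travelers P.
        (\<Sum>m\<in>modes P. v_par P m * l i m) = D_par P i * x i \<and>
        0 \<le> (\<Sum>m\<in>modes P. l i m) - T_par P i * x i \<and>
        (\<Sum>m\<in>modes P. l i m) - T_par P i * x i \<le> R_par P i \<and>
        (\<Sum>m\<in>modes P. sigma_par P m * l i m) \<le> Gamma_par P i \<and>
        b_par P i - p \<ge> (1 - u i) * (b_par P i - p_max P) \<and>
        b_par P i - p \<le> u i * (b_par P i - p_min P) \<and>
        u i \<in> {0, 1} \<and>
        (\<forall>m\<in>modes P. l i m \<ge> 0)) \<and>
     (\<forall>m\<in>modes P.
        (\<Sum>i\<in>travelers P. (v_par P m)\<^sup>2 * l i m) \<le> (\<Sum>n\<in>tsps P m. C_par P (m, n) * y (m, n))) \<and>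
     (\<forall>k\<in>MN P.
        q - beta_par P k \<ge> (1 - w k) * (q_min P - beta_par P k) \<and>
        q - beta_par P k \<le> w k * (q_max P - beta_par P k) \<and>
        w k \<in> {0, 1}) \<and>
     \<Delta> = (\<Sum>k\<in>MN P. C_par P k * y k) - (\<Sum>i\<in>travelers P. Q_par P i * x i) \<and>
     p_min P \<le> p \<and> p \<le> p_max P \<and>
     q_min P \<le> q \<and> q \<le> q_max P \<and>
     C_low P \<le> \<Delta> \<and> \<Delta> \<le> C_up P"

definition traveler_feasible :: "('i, 'm, 'n) slmfg_data \<Rightarrow> 'i \<Rightarrow> real \<Rightarrow> real set" where
  "traveler_feasible P i ui =
     {xi. b_par P i * Q_par P i * xi \<le> B_par P i \<and> xi \<le> ui \<and> xi \<ge> 0}"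

definition traveler_cost ::
  "('i, 'm, 'n) slmfg_data \<Rightarrow> ('i \<Rightarrow> real \<Rightarrow> real \<Rightarrow> real) \<Rightarrow> 'i \<Rightarrow> real \<Rightarrow> real \<Rightarrow> real" where
  "traveler_cost P \<Psi> i xi \<Delta> =
     b_par P i * Q_par P i * xi + r_par P i * Q_par P i * (1 - xi) + alpha_par P i * \<Psi> i xi \<Delta>"

definition traveler_optimal ::
  "('i, 'm, 'n) slmfg_data \<Rightarrow> ('i \<Rightarrow> real \<Rightarrow> real \<Rightarrow> real) \<Rightarrow> 'i \<Rightarrow> real \<Rightarrow> real \<Rightarrow> real \<Rightarrow> bool" where
  "traveler_optimal P \<Psi> i ui \<Delta> xi \<longleftrightarrow>
     is_arg_min (\<lambda>z. traveler_cost P \<Psi> i z \<Delta>) (\<lambda>z. z \<in> traveler_feasible P i ui) xi"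

definition tsp_feasible :: "('i, 'm, 'n) slmfg_data \<Rightarrow> 'm \<times> 'n \<Rightarrow> real \<Rightarrow> real set" where
  "tsp_feasible P k wk =
     {yk. C_par P k * gamma_par P k * yk \<le> Bbar_par P k \<and> yk \<le> wk \<and> yk \<ge> 0}"

definition tsp_profit ::
  "('i, 'm, 'n) slmfg_data \<Rightarrow> ('m \<times> 'n \<Rightarrow> real \<Rightarrow> real \<Rightarrow> real) \<Rightarrow> 'm \<times> 'n \<Rightarrow> real \<Rightarrow> real \<Rightarrow> real" where
  "tsp_profit P \<Phi> k yk \<Delta> =
     (beta_par P k - gamma_par P k) * C_par P k * yk +
     (rho_par P k - gamma_par P k) * C_par P k * (1 - yk) -
     eta_par P k * \<Phi> k yk \<Delta>"

definition tsp_optimal ::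
  "('i, 'm, 'n) slmfg_data \<Rightarrow> ('m \<times> 'n \<Rightarrow> real \<Rightarrow> real \<Rightarrow> real) \<Rightarrow> 'm \<times> 'n \<Rightarrow> real \<Rightarrow> real \<Rightarrow> real \<Rightarrow> bool" where
  "tsp_optimal P \<Phi> k wk \<Delta> yk \<longleftrightarrow>
     is_arg_max (\<lambda>z. tsp_profit P \<Phi> k z \<Delta>) (\<lambda>z. z \<in> tsp_feasible P k wk) yk"

type_synonym ('i, 'm, 'n) slmfg_point =
  "real \<times> real \<times> ('i \<Rightarrow> 'm \<Rightarrow> real) \<times> ('i \<Rightarrow> real) \<times> ('m \<times> 'n \<Rightarrow> real) \<times> real \<times>
   ('i \<Rightarrow> real) \<times> ('m \<times> 'n \<Rightarrow> real)"

definition SLMFG_feasible ::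
  "('i, 'm, 'n) slmfg_data \<Rightarrow> ('i \<Rightarrow> real \<Rightarrow> real \<Rightarrow> real) \<Rightarrow> ('m \<times> 'n \<Rightarrow> real \<Rightarrow> real \<Rightarrow> real) \<Rightarrow>
   ('i, 'm, 'n) slmfg_point set" where
  "SLMFG_feasible P \<Psi> \<Phi> =
     {(p, q, l, u, w, \<Delta>, x, y).
        leader_constraints P p q l u w \<Delta> x y \<and>
        (\<forall>i\<in>travelers P. traveler_optimal P \<Psi> i (u i) \<Delta> (x i)) \<and>
        (\<forall>k\<in>MN P. tsp_optimal P \<Phi> k (w k) \<Delta> (y k))}"

definition SLMFG_global_solution ::
  "('i, 'm, 'n) slmfg_data \<Rightarrow> ('i \<Rightarrow> real \<Rightarrow> real \<Rightarrow> real) \<Rightarrow> ('m \<times> 'n \<Rightarrow> real \<Rightarrow> real \<Rightarrow> real) \<Rightarrow>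
   ('i, 'm, 'n) slmfg_point \<Rightarrow> bool" where
  "SLMFG_global_solution P \<Psi> \<Phi> z \<longleftrightarrow>
     is_arg_max (\<lambda>(p, q, l, u, w, \<Delta>, x, y). leader_objective P x y)
       (\<lambda>z. z \<in> SLMFG_feasible P \<Psi> \<Phi>) z"

definition SLMFG_L_global_solution ::
  "('i, 'm, 'n) slmfg_data \<Rightarrow> ('i, 'm, 'n) slmfg_point \<Rightarrow> bool" where
  "SLMFG_L_global_solution P z \<longleftrightarrow> SLMFG_global_solution P (Psi_lin P) (Phi_lin P) z"

definition complementary :: "real \<Rightarrow> real \<Rightarrow> bool" where
  "complementary a b \<longleftrightarrow> 0 \<le> a \<and> 0 \<le> b \<and> a * b = 0"

definition traveler_KKT ::
  "('i, 'm, 'n) slmfg_data \<Rightarrow> 'i \<Rightarrow> real \<Rightarrow> real \<Rightarrow> real \<times> real \<times> real \<Rightarrow> bool" where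
  "traveler_KKT P i ui xi lam \<longleftrightarrow> (case lam of (lam1, lam2, lam3) \<Rightarrow>
     complementary (B_par P i - b_par P i * Q_par P i * xi) lam1 \<and>
     complementary (ui - xi) lam2 \<and>
     complementary xi lam3 \<and>
     (b_par P i - r_par P i) * Q_par P i - alpha_par P i * (zeta_par P / C_up P) * Q_par P i
       + lam1 * b_par P i * Q_par P i + lam2 - lam3 = 0)"

definition tsp_KKT ::
  "('i, 'm, 'n) slmfg_data \<Rightarrow> 'm \<times> 'n \<Rightarrow> real \<Rightarrow> real \<Rightarrow> real \<times> real \<times> real \<Rightarrow> bool" where
  "tsp_KKT P k wk yk mu \<longleftrightarrow> (case mu of (mu1, mu2, mu3) \<Rightarrow>
     complementary (Bbar_par P k - C_par P k * gamma_par P k * yk) mu1 \<and>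
     complementary (wk - yk) mu2 \<and>
     complementary yk mu3 \<and>
     (rho_par P k - beta_par P k) * C_par P k - eta_par P k * (kappa_par P / C_up P) * C_par P k
       + mu1 * C_par P k * gamma_par P k + mu2 - mu3 = 0)"

definition KKT_multipliers ::
  "('i, 'm, 'n) slmfg_data \<Rightarrow> ('i, 'm, 'n) slmfg_point \<Rightarrow>
   (('i \<Rightarrow> real \<times> real \<times> real) \<times> ('m \<times> 'n \<Rightarrow> real \<times> real \<times> real)) set" where
  "KKT_multipliers P = (\<lambda>(p, q, l, u, w, \<Delta>, x, y).
     {(lam, mu).
        (\<forall>i\<in>travelers P. traveler_KKT P i (u i) (x i) (lam i)) \<and>
        (\<forall>k\<in>MN P. tsp_KKT P k (w k) (y k) (mu k))})"

type_synonym ('i, 'm, 'n) mpec_point =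
  "real \<times> real \<times> ('i \<Rightarrow> 'm \<Rightarrow> real) \<times> ('i \<Rightarrow> real) \<times> ('m \<times> 'n \<Rightarrow> real) \<times> real \<times>
   ('i \<Rightarrow> real) \<times> ('m \<times> 'n \<Rightarrow> real) \<times>
   ('i \<Rightarrow> real \<times> real \<times> real) \<times> ('m \<times> 'n \<Rightarrow> real \<times> real \<times> real)"

definition MPEC_L_feasible :: "('i, 'm, 'n) slmfg_data \<Rightarrow> ('i, 'm, 'n) mpec_point set" where
  "MPEC_L_feasible P =
     {(p, q, l, u, w, \<Delta>, x, y, lam, mu).
        leader_constraints P p q l u w \<Delta> x y \<and>
        (\<forall>i\<in>travelers P. traveler_KKT P i (u i) (x i) (lam i)) \<and>
        (\<forall>k\<in>MN P. tsp_KKT P k (w k) (y k) (mu k))}"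

definition MPEC_L_global_solution ::
  "('i, 'm, 'n) slmfg_data \<Rightarrow> ('i, 'm, 'n) mpec_point \<Rightarrow> bool" where
  "MPEC_L_global_solution P z \<longleftrightarrow>
     is_arg_max (\<lambda>(p, q, l, u, w, \<Delta>, x, y, lam, mu). leader_objective P x y)
       (\<lambda>z. z \<in> MPEC_L_feasible P) z"

end

theory Submission
  imports Defs
begin

text \<open>
  With linear perceived time functions every follower solves a linear program in one real
  variable: with \<open>\<Delta>\<close> fixed, both followers minimize \<open>c * z\<close> plus a constant subject to
  \<open>a * z \<le> B\<close>, \<open>z \<le> s\<close>, \<open>0 \<le> z\<close>.  Because all constraints are linear, the KKT conditions are
  equivalent to optimality, even where the feasible set degenerates to a point, as it does for
  a follower with \<open>u i = 0\<close> or \<open>w k = 0\<close> (\<open>interval_lp_optimal_iff_KKT\<close>, carried over to the followers in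
  \<open>traveler_optimal_iff_KKT\<close> and \<open>tsp_optimal_iff_KKT\<close>).

  Since the leader constraints are the same in both problems, the feasible set of the bilevel
  problem is therefore exactly the projection of the feasible set of the single-level problem
  along the multipliers (\<open>SLMFG_feasible_iff_multipliers\<close>).  The objective does not depend
  on the multipliers, so global solutions correspond: part a) uses that single-level feasible
  points project to bilevel feasible points, part b) that every bilevel feasible competitor
  lifts to a single-level one.
\<close>

text \<open>
  Sufficiency of the KKT conditions is weak duality.  For necessity the multipliers are explicit:
  a slope \<open>c \<noteq> 0\<close> is balanced by a single active constraint, \<open>0 \<le> z\<close> if \<open>c > 0\<close> and one of the
  two upper bounds if \<open>c < 0\<close>.  The signs of \<open>a\<close> and \<open>B\<close> ensure that the feasible set, unless
  empty, is an interval starting at \<open>0\<close>.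
\<close>

lemma interval_lp_optimal_iff_KKT:
  fixes a B c s x :: real
  assumes "a \<ge> 0" "B \<ge> 0"
  shows "is_arg_min (\<lambda>z. c * z) (\<lambda>z. a * z \<le> B \<and> z \<le> s \<and> z \<ge> 0) x \<longleftrightarrow>
         (\<exists>l1 l2 l3. complementary (B - a * x) l1 \<and> complementary (s - x) l2 \<and>
            complementary x l3 \<and> c + l1 * a + l2 - l3 = 0)"
    (is "?opt \<longleftrightarrow> (\<exists>l1 l2 l3. ?KKT l1 l2 l3)")
proof
  assume ?opt
  then have feas: "a * x \<le> B" "x \<le> s" "x \<ge> 0"
    and opt: "\<And>z. a * z \<le> B \<Longrightarrow> z \<le> s \<Longrightarrow> z \<ge> 0 \<Longrightarrow> c * x \<le> c * z"
    by (auto simp: is_arg_min_def not_less)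
  show "\<exists>l1 l2 l3. ?KKT l1 l2 l3"
  proof (cases "c \<ge> 0")
    case True
    have "c * x \<le> 0"
      using opt[of 0] assms feas by simp
    then have "c * x = 0"
      using mult_nonneg_nonneg[OF True feas(3)] by linarith
    then have "?KKT 0 0 c"
      using True feas by (simp add: complementary_def mult.commute)
    then show ?thesis by blast
  next
    case False
    show ?thesis
    proof (cases "x = s")
      case True
      then have "?KKT 0 (- c) 0"
        using \<open>\<not> c \<ge> 0\<close> feas by (simp add: complementary_def)
      then show ?thesis by blast
    next
      case False
      then have "x < s" using feas by simp
      have rightmost: "z \<le> x" if "a * z \<le> B" "z \<le> s" "z \<ge> 0" for z
        using opt[OF that] \<open>\<not> c \<ge> 0\<close> by (simp add: mult_le_cancel_left)
      have "a > 0"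
        using rightmost[of s] assms \<open>x < s\<close> feas by (cases "a = 0") auto
      moreover have "a * x = B"
      proof -
        \<comment> \<open>The right endpoint of the feasible interval.\<close>
        have "min s (B / a) \<le> x"
          using \<open>a > 0\<close> assms \<open>x < s\<close> feas
          by (intro rightmost) (auto simp: min_def field_simps)
        then show ?thesis
          using \<open>a > 0\<close> \<open>x < s\<close> feas by (auto simp: min_def field_simps split: if_splits)
      qed
      ultimately have "?KKT (- c / a) 0 0"
        using \<open>\<not> c \<ge> 0\<close> feas by (simp add: complementary_def divide_nonpos_nonneg)
      then show ?thesis by blast
    qed
  qed
next
  assume "\<exists>l1 l2 l3. ?KKT l1 l2 l3"
  then obtain l1 l2 l3 where
    feas: "a * x \<le> B" "x \<le> s" "x \<ge> 0" and nonneg: "l1 \<ge> 0" "l2 \<ge> 0" "l3 \<ge> 0"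
    and slack: "(B - a * x) * l1 = 0" "(s - x) * l2 = 0" "x * l3 = 0"
    and stationary: "c = l3 - l1 * a - l2"
    unfolding complementary_def by (auto simp: algebra_simps)
  have "c * x \<le> c * z" if z: "a * z \<le> B" "z \<le> s" "z \<ge> 0" for z
  proof -
    have "c * z - c * x = l1 * (B - a * z) + l2 * (s - z) + l3 * z"
      using slack unfolding stationary by algebra
    also have "\<dots> \<ge> 0" using nonneg z by simp
    finally show ?thesis by simp
  qed
  then show ?opt
    using feas by (auto simp: is_arg_min_def not_less)
qed

lemma valid_traveler_bounds:
  assumes "valid_data P" "i \<in> travelers P"
  shows "b_par P i * Q_par P i \<ge> 0" "B_par P i \<ge> 0"
  using assms by (auto simp: valid_data_def Q_par_def)

lemma valid_tsp_bounds:
  assumes "valid_data P" "k \<in> MN P"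
  shows "C_par P k * gamma_par P k \<ge> 0" "Bbar_par P k \<ge> 0"
  using assms by (auto simp: valid_data_def less_imp_le)

text \<open>
  Linearity of the waiting time separates \<open>xi\<close> from \<open>\<Delta>\<close>: the latter only shifts the cost by a
  constant, so the minimizers are the same for every \<open>\<Delta>\<close> and the cost may be replaced by its
  linear part, whose slope is the constant term of the stationarity condition.
\<close>

lemma traveler_optimal_iff_KKT:
  assumes "valid_data P" "i \<in> travelers P"
  shows "traveler_optimal P (Psi_lin P) i ui \<Delta> xi \<longleftrightarrow> (\<exists>lam. traveler_KKT P i ui xi lam)"
proof -
  define c where "c = (b_par P i - r_par P i) * Q_par P i
    - alpha_par P i * (zeta_par P / C_up P) * Q_par P i"
  have "traveler_cost P (Psi_lin P) i z \<Delta> = c * z + traveler_cost P (Psi_lin P) i 0 \<Delta>" for z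
    unfolding traveler_cost_def Psi_lin_def c_def divide_inverse by algebra
  then have less_iff: "traveler_cost P (Psi_lin P) i z \<Delta> < traveler_cost P (Psi_lin P) i z' \<Delta>
      \<longleftrightarrow> c * z < c * z'" for z z'
    by (metis add_less_cancel_right)
  show ?thesis
    using interval_lp_optimal_iff_KKT[OF valid_traveler_bounds[OF assms], of c ui xi]
    unfolding traveler_optimal_def traveler_feasible_def is_arg_min_def less_iff
    by (simp add: traveler_KKT_def c_def mult.assoc)
qed

text \<open>
  The same reduction for a maximizer: the linear part of the negated profit is minimized.
\<close>

lemma tsp_optimal_iff_KKT:
  assumes "valid_data P" "k \<in> MN P"
  shows "tsp_optimal P (Phi_lin P) k wk \<Delta> yk \<longleftrightarrow> (\<exists>mu. tsp_KKT P k wk yk mu)"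
proof -
  define c where "c = (rho_par P k - beta_par P k) * C_par P k
    - eta_par P k * (kappa_par P / C_up P) * C_par P k"
  have "tsp_profit P (Phi_lin P) k z \<Delta> = - (c * z) + tsp_profit P (Phi_lin P) k 0 \<Delta>" for z
    unfolding tsp_profit_def Phi_lin_def c_def divide_inverse by algebra
  then have less_iff: "tsp_profit P (Phi_lin P) k z' \<Delta> < tsp_profit P (Phi_lin P) k z \<Delta>
      \<longleftrightarrow> c * z < c * z'" for z z'
    by (metis add_less_cancel_right neg_less_iff_less)
  show ?thesis
    using interval_lp_optimal_iff_KKT[OF valid_tsp_bounds[OF assms], of c wk yk]
    unfolding tsp_optimal_def tsp_feasible_def is_arg_max_def is_arg_min_def less_iff
    by (simp add: tsp_KKT_def c_def mult.assoc)
qed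

lemma SLMFG_feasible_iff_multipliers:
  assumes "valid_data P"
  shows "(p, q, l, u, w, \<Delta>, x, y) \<in> SLMFG_feasible P (Psi_lin P) (Phi_lin P) \<longleftrightarrow>
         (\<exists>lam mu. (p, q, l, u, w, \<Delta>, x, y, lam, mu) \<in> MPEC_L_feasible P)"
  unfolding SLMFG_feasible_def MPEC_L_feasible_def
  by (simp add: traveler_optimal_iff_KKT[OF assms] tsp_optimal_iff_KKT[OF assms]
      bchoice_iff del: split_paired_Ex)

theorem theorem1:
  fixes P :: "('i, 'm, 'n) slmfg_data"
  assumes "valid_data P"
  shows "(\<forall>p q l u w \<Delta> x y.
            SLMFG_L_global_solution P (p, q, l, u, w, \<Delta>, x, y) \<longrightarrow>
            (\<forall>(lam, mu) \<in> KKT_multipliers P (p, q, l, u, w, \<Delta>, x, y).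
               MPEC_L_global_solution P (p, q, l, u, w, \<Delta>, x, y, lam, mu))) \<and>
         ((\<forall>i\<in>travelers P. b_par P i \<ge> p_min P) \<and>
          (\<forall>m\<in>modes P. \<forall>n\<in>tsps P m. beta_par P (m, n) \<le> q_max P) \<longrightarrow>
          (\<forall>p q l u w \<Delta> x y lam mu.
             MPEC_L_global_solution P (p, q, l, u, w, \<Delta>, x, y, lam, mu) \<longrightarrow>
             SLMFG_L_global_solution P (p, q, l, u, w, \<Delta>, x, y)))"
proof (intro conjI impI allI ballI)
  fix p q l u w \<Delta> x y and lm :: "('i \<Rightarrow> real \<times> real \<times> real) \<times> ('m \<times> 'n \<Rightarrow> real \<times> real \<times> real)"
  assume sol: "SLMFG_L_global_solution P (p, q, l, u, w, \<Delta>, x, y)"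
    and "lm \<in> KKT_multipliers P (p, q, l, u, w, \<Delta>, x, y)"
  moreover obtain lam mu where lm: "lm = (lam, mu)" by (cases lm)
  ultimately have "(p, q, l, u, w, \<Delta>, x, y, lam, mu) \<in> MPEC_L_feasible P"
    by (simp add: SLMFG_L_global_solution_def SLMFG_global_solution_def is_arg_max_def
        SLMFG_feasible_def MPEC_L_feasible_def KKT_multipliers_def)
  moreover have "\<not> leader_objective P x y < leader_objective P x' y'"
    if "(p', q', l', u', w', \<Delta>', x', y', lam', mu') \<in> MPEC_L_feasible P"
    for p' q' l' u' w' \<Delta>' x' y' lam' mu'
  proof -
    have "(p', q', l', u', w', \<Delta>', x', y') \<in> SLMFG_feasible P (Psi_lin P) (Phi_lin P)"
      using that SLMFG_feasible_iff_multipliers[OF assms] by blast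
    then show ?thesis
      using sol unfolding SLMFG_L_global_solution_def SLMFG_global_solution_def is_arg_max_def
      by fastforce
  qed
  ultimately show "case lm of (lam, mu) \<Rightarrow>
      MPEC_L_global_solution P (p, q, l, u, w, \<Delta>, x, y, lam, mu)"
    unfolding lm MPEC_L_global_solution_def is_arg_max_def by auto
next
  fix p q l u w \<Delta> x y lam mu
  assume sol: "MPEC_L_global_solution P (p, q, l, u, w, \<Delta>, x, y, lam, mu)"
  then have "(p, q, l, u, w, \<Delta>, x, y) \<in> SLMFG_feasible P (Psi_lin P) (Phi_lin P)"
    unfolding SLMFG_feasible_iff_multipliers[OF assms] MPEC_L_global_solution_def is_arg_max_def
    by blast
  moreover have "\<not> leader_objective P x y < leader_objective P x' y'"
    if feas': "(p', q', l', u', w', \<Delta>', x', y') \<in> SLMFG_feasible P (Psi_lin P) (Phi_lin P)"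
    for p' q' l' u' w' \<Delta>' x' y'
  proof -
    obtain lam' mu' where "(p', q', l', u', w', \<Delta>', x', y', lam', mu') \<in> MPEC_L_feasible P"
      using feas' SLMFG_feasible_iff_multipliers[OF assms] by blast
    then show ?thesis
      using sol unfolding MPEC_L_global_solution_def is_arg_max_def by fastforce
  qed
  ultimately show "SLMFG_L_global_solution P (p, q, l, u, w, \<Delta>, x, y)"
    unfolding SLMFG_L_global_solution_def SLMFG_global_solution_def is_arg_max_def by auto
qed

end
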